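(* Let $\Bbbk$ be a field of arbitrary characteristic. Let $R$ and $S$ be standard graded polynomial rings over $\Bbbk$ with $\dim R\ge 1$, $\dim S\ge 1$ and graded maximal ideals $\mathfrak m$ and $\mathfrak n$, and let $T=R\otimes_\Bbbk S$. Let $I\subseteq\mathfrak m^2$ and $J\subseteq\mathfrak n^2$ be homogeneous ideals of $R$ and $S$, respectively, and let $F=I+J+\mathfrak m\mathfrak n\subseteq T$. Assume that $\min\{\operatorname{depth}(R/I),\operatorname{depth}(S/J)\}\ge 1$. Then for all $s\ge 1$, $$F^{(s)}=\sum_{i=0}^{s}\sum_{t=0}^{s}(I^{(i)}\cap \mathfrak m^{s-t})(J^{(t)}\cap\mathfrak n^{s-i}).$$
   Context: Ideals of $R$ and $S$ are identified with their extensions to $T$. For an ideal $K$ of a noetherian ring $A$ and $s\ge 1$, the $s$-th symbolic power is defined via associated primes: $K^{(s)}=\bigcap_{P\in \operatorname{Ass}(A/K)}(K^sA_P\cap A)$; zeroth powers, ordinary or symbolic, are the whole ring. Depth is taken with respect to the graded maximal ideal. *)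

theory Defs
  imports
    "HOL-Library.Poly_Mapping"
    "HOL-Library.Set_Algebras"
    "HOL-Library.Extended_Nat"
begin

section \<open>Ideals\<close>

text \<open>
  The ideals of a commutative ring are the submodules of the ring over itself. Sums of ideals
  are the elementwise sums of \<^theory>\<open>HOL-Library.Set_Algebras\<close>; the elementwise product
  of that theory is not the product of ideals, so ideal products and powers are defined here.
  The locale \<open>module\<close> is not interpreted globally: its simp rule \<open>scale_scale\<close> would
  make rewriting with \<open>algebra_simps\<close> loop.
\<close>

lemma module_mult: "module ((*) :: 'a::comm_ring_1 \<Rightarrow> 'a \<Rightarrow> 'a)"
  by unfold_locales (simp_all add: algebra_simps)

abbreviation is_ideal :: "'a::comm_ring_1 set \<Rightarrow> bool" where
  "is_ideal \<equiv> module.subspace (*)"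

abbreviation gen_ideal :: "'a::comm_ring_1 set \<Rightarrow> 'a set" where
  "gen_ideal \<equiv> module.span (*)"

definition ideal_prod :: "'a::comm_ring_1 set \<Rightarrow> 'a set \<Rightarrow> 'a set" where
  "ideal_prod K L = gen_ideal {a * b |a b. a \<in> K \<and> b \<in> L}"

primrec ideal_pow :: "'a::comm_ring_1 set \<Rightarrow> nat \<Rightarrow> 'a set" where
  "ideal_pow K 0 = UNIV"
| "ideal_pow K (Suc n) = ideal_prod K (ideal_pow K n)"

definition prime_ideal :: "'a::comm_ring_1 set \<Rightarrow> bool" where
  "prime_ideal P \<longleftrightarrow> is_ideal P \<and> P \<noteq> UNIV \<and> (\<forall>a b. a * b \<in> P \<longrightarrow> a \<in> P \<or> b \<in> P)"

text \<open>\<open>Ass(A/K)\<close>: the primes of the form \<open>ann(a + K)\<close>, where \<open>a + K \<in> A/K\<close>.\<close>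

definition assoc_primes :: "'a::comm_ring_1 set \<Rightarrow> 'a set set" where
  "assoc_primes K = {P. prime_ideal P \<and> (\<exists>a. P = {r. r * a \<in> K})}"


section \<open>Localization at a prime and symbolic powers\<close>

text \<open>
  \<open>A\<^sub>P\<close> is the set of classes of pairs (numerator, denominator) with denominator outside \<open>P\<close>;
  \<open>frac P a u\<close> is the fraction \<open>a/u\<close>. The ideal \<open>K A\<^sub>P\<close> consists of the fractions \<open>k/u\<close>
  with \<open>k \<in> K\<close>, and \<open>K A\<^sub>P \<inter> A\<close> is its preimage under \<open>a \<mapsto> a/1\<close>.
\<close>

definition loc_rel :: "'a::comm_ring_1 set \<Rightarrow> (('a \<times> 'a) \<times> ('a \<times> 'a)) set" where
  "loc_rel P = {((a, u), (b, v)). u \<notin> P \<and> v \<notin> P \<and> (\<exists>w. w \<notin> P \<and> w * (a * v - b * u) = 0)}"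

definition frac :: "'a::comm_ring_1 set \<Rightarrow> 'a \<Rightarrow> 'a \<Rightarrow> ('a \<times> 'a) set" where
  "frac P a u = loc_rel P `` {(a, u)}"

definition loc_ideal :: "'a::comm_ring_1 set \<Rightarrow> 'a set \<Rightarrow> ('a \<times> 'a) set set" where
  "loc_ideal P K = {frac P k u |k u. k \<in> K \<and> u \<notin> P}"

definition loc_contract :: "'a::comm_ring_1 set \<Rightarrow> ('a \<times> 'a) set set \<Rightarrow> 'a set" where
  "loc_contract P L = {a. frac P a 1 \<in> L}"

lemma equiv_loc_rel:
  assumes "prime_ideal P"
  shows "equiv (UNIV \<times> - P) (loc_rel P)"
proof (rule equivI)
  have one: "1 \<notin> P"
  proof
    assume "1 \<in> P"
    then have "c * 1 \<in> P" for c
      using assms by (intro module.subspace_scale[OF module_mult]) (simp_all add: prime_ideal_def)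
    then have "P = UNIV" by auto
    then show False using assms by (simp add: prime_ideal_def)
  qed
  have mult: "a * b \<notin> P" if "a \<notin> P" "b \<notin> P" for a b
    using that assms by (auto simp: prime_ideal_def)
  show "loc_rel P \<subseteq> (UNIV \<times> - P) \<times> (UNIV \<times> - P)"
    by (auto simp: loc_rel_def)
  show "refl_on (UNIV \<times> - P) (loc_rel P)"
    unfolding refl_on_def loc_rel_def using one by auto
  show "sym (loc_rel P)"
  proof (rule symI, clarsimp simp: loc_rel_def)
    fix a u b v w :: 'a
    assume *: "w \<notin> P" "w * (a * v - b * u) = 0"
    have "w * (b * u - a * v) = - (w * (a * v - b * u))"
      by (simp only: right_diff_distrib minus_diff_eq)
    with * have "w * (b * u - a * v) = 0" by simp
    with * show "\<exists>w. w \<notin> P \<and> w * (b * u - a * v) = 0" by blast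
  qed
  show "trans (loc_rel P)"
  proof (rule transI, clarsimp simp: loc_rel_def)
    fix a u b v c t w x :: 'a
    assume *: "v \<notin> P" "w \<notin> P" "w * (a * v - b * u) = 0" "x \<notin> P" "x * (b * t - c * v) = 0"
    have "(w * x * v) * (a * t - c * u)
        = (w * (a * v - b * u)) * (x * t) + (x * (b * t - c * v)) * (w * u)"
      by (simp add: algebra_simps)
    also have "\<dots> = 0"
      by (simp only: *(3) *(5) mult_zero_left add_0_left)
    finally have "(w * x * v) * (a * t - c * u) = 0" .
    moreover have "w * x * v \<notin> P"
      by (intro mult *(1) *(2) *(4))
    ultimately show "\<exists>w. w \<notin> P \<and> w * (a * t - c * u) = 0"
      by (intro exI[of _ "w * x * v"] conjI)
  qed
qed

text \<open>
  The intersection over the empty set is the whole ring, so every symbolic power of the unit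
  ideal is the unit ideal.
\<close>

definition symb_pow :: "'a::comm_ring_1 set \<Rightarrow> nat \<Rightarrow> 'a set" where
  "symb_pow K s =
    (if s = 0 then UNIV
     else (\<Inter>P\<in>assoc_primes K. loc_contract P (loc_ideal P (ideal_pow K s))))"


section \<open>Depth\<close>

text \<open>
  \<open>xs\<close> is a regular sequence on \<open>A/K\<close>: each entry is a nonzerodivisor modulo \<open>K\<close> and the
  preceding entries, and \<open>A/(K + (xs))\<close> is nonzero.
\<close>

definition regular_seq :: "'a::comm_ring_1 set \<Rightarrow> 'a list \<Rightarrow> bool" where
  "regular_seq K xs \<longleftrightarrow>
    K + gen_ideal (set xs) \<noteq> UNIV \<and>
    (\<forall>i<length xs. \<forall>a. xs ! i * a \<in> K + gen_ideal (set (take i xs)) \<longrightarrow>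
       a \<in> K + gen_ideal (set (take i xs)))"

text \<open>The depth of \<open>A/K\<close> with respect to the ideal \<open>M\<close>.\<close>

definition depth :: "'a::comm_ring_1 set \<Rightarrow> 'a set \<Rightarrow> enat" where
  "depth M K = Sup {enat (length xs) |xs. set xs \<subseteq> M \<and> regular_seq K xs}"


section \<open>Polynomial rings\<close>

text \<open>
  The polynomial ring over \<open>'k\<close> in the variables indexed by a finite type \<open>'x\<close>: a polynomial
  maps exponent vectors \<open>'x \<Rightarrow>\<^sub>0 nat\<close> to coefficients. Types are nonempty, so there is at
  least one variable.
\<close>

type_synonym ('x, 'k) pol = "('x \<Rightarrow>\<^sub>0 nat) \<Rightarrow>\<^sub>0 'k"

definition var :: "'x \<Rightarrow> ('x, 'k::comm_ring_1) pol" where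
  "var i = Poly_Mapping.single (Poly_Mapping.single i 1) 1"

definition max_ideal :: "('x, 'k::comm_ring_1) pol set" where
  "max_ideal = gen_ideal (var ` UNIV)"

definition mon_degree :: "('x \<Rightarrow>\<^sub>0 nat) \<Rightarrow> nat" where
  "mon_degree m = (\<Sum>i\<in>Poly_Mapping.keys m. Poly_Mapping.lookup m i)"

definition homogeneous :: "('x, 'k::comm_ring_1) pol \<Rightarrow> bool" where
  "homogeneous p \<longleftrightarrow> (\<exists>d. \<forall>m\<in>Poly_Mapping.keys p. mon_degree m = d)"

definition homogeneous_ideal :: "('x, 'k::comm_ring_1) pol set \<Rightarrow> bool" where
  "homogeneous_ideal K \<longleftrightarrow> (\<exists>B. (\<forall>b\<in>B. homogeneous b) \<and> K = gen_ideal B)"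

definition push_keys :: "('a \<Rightarrow> 'b) \<Rightarrow> ('a \<Rightarrow>\<^sub>0 'c) \<Rightarrow> ('b \<Rightarrow>\<^sub>0 'c::comm_monoid_add)" where
  "push_keys f p = (\<Sum>a\<in>Poly_Mapping.keys p. Poly_Mapping.single (f a) (Poly_Mapping.lookup p a))"

text \<open>
  \<open>rename f\<close> is the \<open>'k\<close>-algebra homomorphism with \<open>var i \<mapsto> var (f i)\<close>. The tensor product
  of the polynomial rings in the variables \<open>'x\<close> and \<open>'y\<close> is the polynomial ring in the
  variables \<open>'x + 'y\<close>, with the canonical maps \<open>p \<mapsto> p \<otimes> 1\<close> and \<open>q \<mapsto> 1 \<otimes> q\<close> given by
  \<open>rename Inl\<close> and \<open>rename Inr\<close>.
\<close>

definition rename :: "('x \<Rightarrow> 'y) \<Rightarrow> ('x, 'k::comm_ring_1) pol \<Rightarrow> ('y, 'k) pol" where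
  "rename f = push_keys (push_keys f)"

definition extend :: "('x \<Rightarrow> 'y) \<Rightarrow> ('x, 'k::comm_ring_1) pol set \<Rightarrow> ('y, 'k) pol set" where
  "extend f K = gen_ideal (rename f ` K)"

end

theory Submission
  imports Defs
begin

text \<open>
  An element of \<open>T\<close> lies in \<open>F\<close> iff setting \<open>y = 0\<close> sends it into \<open>I\<close> and setting \<open>x = 0\<close> sends it
  into \<open>J\<close>. Since the depths are positive, \<open>m\<close> and \<open>n\<close> contain nonzerodivisors modulo \<open>I\<close> and
  \<open>J\<close>, and this gives \<open>Ass(T/F) = {P + n} \<union> {Q + m}\<close> with \<open>P\<close> in \<open>Ass(R/I)\<close> and \<open>Q\<close> in
  \<open>Ass(S/J)\<close>. At \<open>P + n\<close> the ideal \<open>F\<close> becomes \<open>I + n\<close>, because some element of \<open>m\<close> becomes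
  a unit. Hence \<open>f\<close> lies in \<open>F\<^sup>(\<^sup>s\<^sup>)\<close> iff its coefficient at every monomial \<open>y\<^sup>b\<close> lies in the
  symbolic power of \<open>I\<close> of exponent \<open>s - |b|\<close>, and symmetrically for \<open>J\<close>. Such an \<open>f\<close> is a sum of
  products \<open>u v\<close> with \<open>u \<in> R\<close> and \<open>v \<in> S\<close> as required, by Gaussian elimination on its matrix of
  coefficients with pivots of minimal total degree.
\<close>

section \<open>Ideals and saturations\<close>

lemma is_ideal_iff:
  "is_ideal K \<longleftrightarrow> 0 \<in> K \<and> (\<forall>a\<in>K. \<forall>b\<in>K. a + b \<in> K) \<and> (\<forall>r. \<forall>a\<in>K. r * a \<in> K)"
  using module.subspace_def[OF module_mult, of K] by auto

lemma is_idealI: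
  assumes "0 \<in> K" "\<And>a b. a \<in> K \<Longrightarrow> b \<in> K \<Longrightarrow> a + b \<in> K" "\<And>r a. a \<in> K \<Longrightarrow> r * a \<in> K"
  shows "is_ideal K"
  using assms by (simp add: is_ideal_iff)

lemma
  assumes "is_ideal K"
  shows ideal_zero: "0 \<in> K"
    and ideal_add: "a \<in> K \<Longrightarrow> b \<in> K \<Longrightarrow> a + b \<in> K"
    and ideal_mult_left: "a \<in> K \<Longrightarrow> r * a \<in> K"
    and ideal_mult_right: "a \<in> K \<Longrightarrow> a * r \<in> K"
    and ideal_diff: "a \<in> K \<Longrightarrow> b \<in> K \<Longrightarrow> a - b \<in> K"
    and ideal_sum: "(\<And>x. x \<in> X \<Longrightarrow> f x \<in> K) \<Longrightarrow> sum f X \<in> K"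
  using assms module.subspace_diff[OF module_mult, of K a b]
    module.subspace_sum[OF module_mult, of K X f]
  by (auto simp: is_ideal_iff mult.commute[of a r])

lemma is_ideal_gen_ideal: "is_ideal (gen_ideal X)"
  by (rule module.subspace_span[OF module_mult])

lemma gen_ideal_superset: "X \<subseteq> gen_ideal X"
  using module.span_superset[OF module_mult] .

lemma gen_ideal_minimal: "X \<subseteq> K \<Longrightarrow> is_ideal K \<Longrightarrow> gen_ideal X \<subseteq> K"
  by (rule module.span_minimal[OF module_mult])

lemma is_ideal_ideal_prod: "is_ideal (ideal_prod K L)"
  unfolding ideal_prod_def by (rule is_ideal_gen_ideal)

lemma ideal_prod_mem: "a \<in> K \<Longrightarrow> b \<in> L \<Longrightarrow> a * b \<in> ideal_prod K L"
  unfolding ideal_prod_def by (rule subsetD[OF gen_ideal_superset]) blast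

lemma ideal_prod_least:
  assumes "is_ideal M" "\<And>a b. a \<in> K \<Longrightarrow> b \<in> L \<Longrightarrow> a * b \<in> M"
  shows "ideal_prod K L \<subseteq> M"
  unfolding ideal_prod_def by (rule gen_ideal_minimal[OF _ assms(1)]) (use assms(2) in blast)

lemma gen_ideal_prod_least:
  assumes M: "is_ideal M" and AB: "\<And>a b. a \<in> A \<Longrightarrow> b \<in> B \<Longrightarrow> a * b \<in> M"
  shows "ideal_prod (gen_ideal A) (gen_ideal B) \<subseteq> M"
proof (rule ideal_prod_least[OF M])
  have *: "b * a \<in> M" if "a \<in> gen_ideal X" "\<And>a. a \<in> X \<Longrightarrow> b * a \<in> M" for X a b
  proof -
    have "is_ideal {a. b * a \<in> M}"
      using M by (auto simp: is_ideal_iff distrib_left mult.left_commute)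
    from gen_ideal_minimal[OF _ this, of X] that show ?thesis by blast
  qed
  fix a b assume "a \<in> gen_ideal A" "b \<in> gen_ideal B"
  show "a * b \<in> M"
  proof (rule *[OF \<open>b \<in> gen_ideal B\<close>])
    fix b' assume "b' \<in> B"
    then have "b' * a \<in> M"
      by (intro *[OF \<open>a \<in> gen_ideal A\<close>]) (simp add: AB mult.commute[of b'])
    then show "a * b' \<in> M" by (simp add: mult.commute)
  qed
qed

lemma is_ideal_set_plus:
  assumes "is_ideal K" "is_ideal L"
  shows "is_ideal (K + L)"
proof (rule is_idealI)
  show "0 \<in> K + L"
    using set_plus_intro[OF ideal_zero[OF assms(1)] ideal_zero[OF assms(2)]] by simp
next
  fix a b assume "a \<in> K + L" "b \<in> K + L"
  then obtain k l k' l' where "a = k + l" "b = k' + l'" "k \<in> K" "l \<in> L" "k' \<in> K" "l' \<in> L"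
    by (elim set_plus_elim)
  moreover from this have "(k + k') + (l + l') \<in> K + L"
    by (intro set_plus_intro ideal_add[OF assms(1)] ideal_add[OF assms(2)])
  ultimately show "a + b \<in> K + L" by (simp add: algebra_simps)
next
  fix r a assume "a \<in> K + L"
  then obtain k l where "a = k + l" "k \<in> K" "l \<in> L" by (elim set_plus_elim)
  moreover from this have "r * k + r * l \<in> K + L"
    by (intro set_plus_intro ideal_mult_left[OF assms(1)] ideal_mult_left[OF assms(2)])
  ultimately show "r * a \<in> K + L" by (simp add: distrib_left)
qed

lemma set_plus_superset_left: "is_ideal L \<Longrightarrow> K \<subseteq> K + L"
  by (metis add.right_neutral ideal_zero set_plus_intro subsetI)

lemma set_plus_superset_right: "is_ideal K \<Longrightarrow> L \<subseteq> K + L"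
  by (metis add.commute set_plus_superset_left)

lemma set_plus_least: "is_ideal M \<Longrightarrow> K \<subseteq> M \<Longrightarrow> L \<subseteq> M \<Longrightarrow> K + L \<subseteq> M"
  by (auto elim!: set_plus_elim intro: ideal_add)

lemma ideal_sum_sets:
  assumes "finite X" "\<And>x. x \<in> X \<Longrightarrow> is_ideal (K x)"
  shows "is_ideal (\<Sum>x\<in>X. K x)" and "\<And>x. x \<in> X \<Longrightarrow> K x \<subseteq> (\<Sum>x\<in>X. K x)"
proof -
  have "is_ideal (\<Sum>x\<in>X. K x) \<and> (\<forall>x\<in>X. K x \<subseteq> (\<Sum>x\<in>X. K x))"
    using assms
  proof (induction X rule: finite_induct)
    case empty
    then show ?case by (auto simp: is_ideal_iff)
  next
    case (insert x X)
    then have "K y \<subseteq> K x + (\<Sum>x\<in>X. K x)" if "y \<in> insert x X" for y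
      using that set_plus_superset_left[of "\<Sum>x\<in>X. K x" "K x"]
        set_plus_superset_right[of "K x" "\<Sum>x\<in>X. K x"] by blast
    with insert show ?case by (auto intro: is_ideal_set_plus)
  qed
  then show "is_ideal (\<Sum>x\<in>X. K x)" and "\<And>x. x \<in> X \<Longrightarrow> K x \<subseteq> (\<Sum>x\<in>X. K x)" by auto
qed

lemma sum_sets_least:
  assumes "is_ideal M" "\<And>x. x \<in> X \<Longrightarrow> K x \<subseteq> M"
  shows "(\<Sum>x\<in>X. K x) \<subseteq> M"
  using assms(2)
proof (induction X rule: infinite_finite_induct)
  case (insert x X)
  then show ?case using set_plus_least[OF assms(1)] by auto
qed (use ideal_zero[OF assms(1)] in auto)

lemma is_ideal_ideal_pow: "is_ideal (ideal_pow K n)"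
  by (cases n) (simp_all add: is_ideal_ideal_prod is_ideal_iff[of UNIV])

lemma ideal_pow_Suc_mem: "a \<in> K \<Longrightarrow> b \<in> ideal_pow K n \<Longrightarrow> a * b \<in> ideal_pow K (Suc n)"
  by (simp add: ideal_prod_mem)

lemma ideal_pow_one: "is_ideal K \<Longrightarrow> ideal_pow K (Suc 0) = K"
  using ideal_prod_least[of K K UNIV] ideal_prod_mem[of _ K 1 UNIV]
  by (force intro: ideal_mult_right)

lemma ideal_pow_mult:
  assumes "b \<in> ideal_pow K n" "a \<in> ideal_pow K m"
  shows "a * b \<in> ideal_pow K (m + n)"
  using assms(2)
proof (induction m arbitrary: a)
  case 0
  then show ?case using ideal_mult_left[OF is_ideal_ideal_pow assms(1)] by simp
next
  case (Suc m)
  have "is_ideal {a. a * b \<in> ideal_pow K (Suc m + n)}"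
    using is_ideal_ideal_pow[of K "Suc m + n"]
    by (auto simp: is_ideal_iff distrib_right mult.assoc)
  then have "ideal_prod K (ideal_pow K m) \<subseteq> {a. a * b \<in> ideal_pow K (Suc m + n)}"
    by (rule ideal_prod_least) (use Suc.IH in \<open>simp add: mult.assoc ideal_prod_mem\<close>)
  with Suc.prems show ?case by auto
qed

lemma ideal_pow_antimono:
  assumes "m \<le> n"
  shows "ideal_pow K n \<subseteq> ideal_pow K m"
proof -
  have "ideal_pow K (m + d) \<subseteq> ideal_pow K m" for d
  proof (induction d)
    case (Suc d)
    have "ideal_prod K (ideal_pow K (m + d)) \<subseteq> ideal_pow K (m + d)"
      by (intro ideal_prod_least is_ideal_ideal_pow ideal_mult_left)
    with Suc show ?case by simp
  qed simp
  from this[of "n - m"] assms show ?thesis by simp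
qed

lemma
  assumes "prime_ideal P"
  shows prime_ideal_ideal: "is_ideal P"
    and prime_ideal_one: "1 \<notin> P"
    and prime_ideal_mult: "a * b \<in> P \<Longrightarrow> a \<in> P \<or> b \<in> P"
proof -
  show P: "is_ideal P" "a * b \<in> P \<Longrightarrow> a \<in> P \<or> b \<in> P"
    using assms by (auto simp: prime_ideal_def)
  have "P = UNIV" if "1 \<in> P"
    using ideal_mult_left[OF P(1) that] by auto
  then show "1 \<notin> P"
    using assms unfolding prime_ideal_def by blast
qed

lemma prime_ideal_power: "prime_ideal P \<Longrightarrow> a \<notin> P \<Longrightarrow> a ^ n \<notin> P"
  by (induction n) (auto simp: prime_ideal_one dest: prime_ideal_mult)

definition saturation :: "'a::comm_ring_1 set \<Rightarrow> 'a set \<Rightarrow> 'a set" where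
  "saturation P K = {a. \<exists>u. u \<notin> P \<and> u * a \<in> K}"

lemma loc_contract_loc_ideal:
  assumes P: "prime_ideal P" and K: "is_ideal K"
  shows "loc_contract P (loc_ideal P K) = saturation P K"
proof -
  have "frac P a 1 = frac P k u \<longleftrightarrow> (\<exists>w. w \<notin> P \<and> w * (a * u - k * 1) = 0)" if "u \<notin> P" for a k u
    unfolding frac_def
    using eq_equiv_class_iff[OF equiv_loc_rel[OF P], of "(a, 1)" "(k, u)"] that prime_ideal_one[OF P]
    by (auto simp: loc_rel_def)
  then have "a \<in> loc_contract P (loc_ideal P K) \<longleftrightarrow>
      (\<exists>k u w. k \<in> K \<and> u \<notin> P \<and> w \<notin> P \<and> w * (a * u - k) = 0)" for a
    by (simp add: loc_contract_def loc_ideal_def) metis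
  also have "\<dots> a \<longleftrightarrow> a \<in> saturation P K" for a
  proof
    assume "\<exists>k u w. k \<in> K \<and> u \<notin> P \<and> w \<notin> P \<and> w * (a * u - k) = 0"
    then obtain k u w where *: "k \<in> K" "u \<notin> P" "w \<notin> P" "w * (a * u - k) = 0" by blast
    then have "(w * u) * a = w * k" by (simp add: algebra_simps)
    moreover have "w * u \<notin> P" using * prime_ideal_mult[OF P] by blast
    ultimately show "a \<in> saturation P K"
      unfolding saturation_def using ideal_mult_left[OF K \<open>k \<in> K\<close>, of w] by auto
  next
    assume "a \<in> saturation P K"
    then obtain u where "u \<notin> P" "u * a \<in> K" by (auto simp: saturation_def)
    then show "\<exists>k u w. k \<in> K \<and> u \<notin> P \<and> w \<notin> P \<and> w * (a * u - k) = 0"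
      using prime_ideal_one[OF P]
      by (intro exI[of _ "u * a"] exI[of _ u] exI[of _ 1]) (simp add: mult.commute)
  qed
  finally show ?thesis by blast
qed

lemma symb_pow_saturation:
  "symb_pow K s = (\<Inter>P\<in>assoc_primes K. saturation P (ideal_pow K s))"
proof (cases "s = 0")
  case True
  then show ?thesis
    using prime_ideal_one by (auto simp: symb_pow_def saturation_def assoc_primes_def)
next
  case False
  then show ?thesis
    by (auto simp: symb_pow_def assoc_primes_def loc_contract_loc_ideal is_ideal_ideal_pow)
qed

lemma saturation_mono: "K \<subseteq> L \<Longrightarrow> saturation P K \<subseteq> saturation P L"
  by (auto simp: saturation_def)

lemma saturation_superset: "prime_ideal P \<Longrightarrow> K \<subseteq> saturation P K"
  using prime_ideal_one by (force simp: saturation_def)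

lemma saturation_cancel:
  assumes "prime_ideal P" "u \<notin> P" "u * a \<in> saturation P K"
  shows "a \<in> saturation P K"
proof -
  from assms(3) obtain w where "w \<notin> P" "(w * u) * a \<in> K" by (auto simp: saturation_def mult.assoc)
  with assms(1,2) show ?thesis unfolding saturation_def by (blast dest: prime_ideal_mult)
qed

lemma is_ideal_saturation:
  assumes P: "prime_ideal P" and K: "is_ideal K"
  shows "is_ideal (saturation P K)"
proof (rule is_idealI)
  show "0 \<in> saturation P K"
    using saturation_superset[OF P] ideal_zero[OF K] by blast
next
  fix a b assume "a \<in> saturation P K" "b \<in> saturation P K"
  then obtain u v where *: "u \<notin> P" "u * a \<in> K" "v \<notin> P" "v * b \<in> K" by (auto simp: saturation_def)
  have "v * (u * a) + u * (v * b) \<in> K"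
    by (intro ideal_add[OF K] ideal_mult_left[OF K] *(2,4))
  then have "(u * v) * (a + b) \<in> K" by (simp add: algebra_simps)
  with * show "a + b \<in> saturation P K"
    unfolding saturation_def by (blast dest: prime_ideal_mult[OF P])
next
  fix r a assume "a \<in> saturation P K"
  then obtain u where "u \<notin> P" "u * a \<in> K" by (auto simp: saturation_def)
  then show "r * a \<in> saturation P K"
    unfolding saturation_def using ideal_mult_left[OF K, of "u * a" r]
    by (auto simp: mult.left_commute)
qed

lemma saturation_common_denominator:
  assumes P: "prime_ideal P" and K: "\<And>x. x \<in> X \<Longrightarrow> is_ideal (K x)" and "finite X"
    and "\<And>x. x \<in> X \<Longrightarrow> f x \<in> saturation P (K x)"
  obtains u where "u \<notin> P" "\<And>x. x \<in> X \<Longrightarrow> u * f x \<in> K x"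
proof -
  from assms(4) obtain v where v: "v x \<notin> P" "v x * f x \<in> K x" if "x \<in> X" for x
    unfolding saturation_def by simp metis
  show thesis
  proof
    from \<open>finite X\<close> v(1) show "prod v X \<notin> P"
      by (induction X rule: finite_induct) (auto simp: prime_ideal_one[OF P] dest: prime_ideal_mult[OF P])
    show "prod v X * f x \<in> K x" if "x \<in> X" for x
    proof -
      have "prod v X * f x = prod v (X - {x}) * (v x * f x)"
        using prod.remove[OF \<open>finite X\<close> that, of v] by (simp add: mult_ac)
      then show ?thesis using ideal_mult_left[OF K[OF that] v(2)[OF that]] by simp
    qed
  qed
qed

lemma is_ideal_symb_pow: "is_ideal (symb_pow K n)"
proof -
  have "is_ideal (saturation P (ideal_pow K n))" if "P \<in> assoc_primes K" for P
    using that is_ideal_saturation is_ideal_ideal_pow by (auto simp: assoc_primes_def)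
  then show ?thesis
    unfolding symb_pow_saturation by (intro module.subspace_Int[OF module_mult])
qed

lemma symb_pow_antimono: "m \<le> n \<Longrightarrow> symb_pow K n \<subseteq> symb_pow K m"
  unfolding symb_pow_saturation
  by (intro INF_mono' saturation_mono ideal_pow_antimono)

lemma depth_nonzerodivisor:
  assumes "1 \<le> depth M K" "is_ideal K"
  obtains x where "x \<in> M" "\<And>a. x * a \<in> K \<Longrightarrow> a \<in> K"
proof -
  have "\<exists>xs. set xs \<subseteq> M \<and> regular_seq K xs \<and> xs \<noteq> []"
  proof (rule ccontr)
    assume "\<not> ?thesis"
    then have "depth M K \<le> 0"
      unfolding depth_def by (intro Sup_least) (auto simp: zero_enat_def)
    with assms(1) show False by simp
  qed
  then obtain x xs where x: "set (x # xs) \<subseteq> M" "regular_seq K (x # xs)"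
    by (metis list.exhaust)
  have "gen_ideal ({} :: 'a set) = {0}" by (rule module.span_empty[OF module_mult])
  then have "K + gen_ideal (set (take 0 (x # xs))) = K" by (simp add: set_plus_def)
  with x(2) have "x * a \<in> K \<Longrightarrow> a \<in> K" for a
    unfolding regular_seq_def by (metis length_greater_0_conv list.discI nth_Cons_0)
  with x(1) that show thesis by auto
qed

section \<open>Coefficients with respect to a block of variables\<close>

lemma lookup_sum_single:
  "finite X \<Longrightarrow> Poly_Mapping.lookup (\<Sum>a\<in>X. Poly_Mapping.single a (h a)) b = (if b \<in> X then h b else 0)"
  by (simp add: lookup_sum lookup_single when_def)

lemma poly_mapping_sum_single:
  "f = (\<Sum>a\<in>Poly_Mapping.keys f. Poly_Mapping.single a (Poly_Mapping.lookup f a))"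
  by (rule poly_mapping_eqI) (simp add: lookup_sum_single in_keys_iff)

lemma mult_sum_single:
  "f * g = (\<Sum>a\<in>Poly_Mapping.keys f. \<Sum>b\<in>Poly_Mapping.keys g.
     Poly_Mapping.single (a + b) (Poly_Mapping.lookup f a * Poly_Mapping.lookup g b))"
  for f g :: "'a::comm_monoid_add \<Rightarrow>\<^sub>0 'b::comm_semiring_0"
proof -
  have "f * g = (\<Sum>a\<in>Poly_Mapping.keys f. Poly_Mapping.single a (Poly_Mapping.lookup f a)) *
      (\<Sum>b\<in>Poly_Mapping.keys g. Poly_Mapping.single b (Poly_Mapping.lookup g b))"
    by (simp flip: poly_mapping_sum_single)
  then show ?thesis by (simp add: sum_product mult_single)
qed

lemma lookup_mult_keys:
  "Poly_Mapping.lookup (f * g) k = (\<Sum>a\<in>Poly_Mapping.keys f. \<Sum>b\<in>Poly_Mapping.keys g.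
     if a + b = k then Poly_Mapping.lookup f a * Poly_Mapping.lookup g b else 0)"
  for f g :: "'a::comm_monoid_add \<Rightarrow>\<^sub>0 'b::comm_semiring_0"
  by (subst mult_sum_single) (simp add: lookup_sum lookup_single when_def)

lemma lookup_single_zero_mult:
  "Poly_Mapping.lookup (Poly_Mapping.single 0 c * f) k = c * Poly_Mapping.lookup f k"
  for f :: "'a::comm_monoid_add \<Rightarrow>\<^sub>0 'b::comm_semiring_0"
  by (simp add: mult_map_scale_conv_mult[symmetric] Poly_Mapping.map.rep_eq when_def)

definition additive_extension :: "('a \<Rightarrow> 'b \<Rightarrow> 'c) \<Rightarrow> ('a \<Rightarrow>\<^sub>0 'b::zero) \<Rightarrow> 'c::comm_monoid_add" where
  "additive_extension h f = (\<Sum>a\<in>Poly_Mapping.keys f. h a (Poly_Mapping.lookup f a))"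

lemma additive_extension_zero [simp]: "additive_extension h 0 = 0"
  by (simp add: additive_extension_def)

lemma additive_extension_single:
  "(\<And>a. h a 0 = 0) \<Longrightarrow> additive_extension h (Poly_Mapping.single a c) = h a c"
  by (cases "c = 0") (auto simp: additive_extension_def)

context
  fixes h :: "'a \<Rightarrow> 'b::comm_monoid_add \<Rightarrow> 'c::comm_monoid_add"
  assumes h_zero: "\<And>a. h a 0 = 0" and h_add: "\<And>a c d. h a (c + d) = h a c + h a d"
begin

lemma additive_extension_add:
  "additive_extension h (f + g) = additive_extension h f + additive_extension h g"
  unfolding additive_extension_def by (rule setsum_keys_plus_distrib[of h]) (simp_all only: h_zero h_add)

lemma additive_extension_sum:
  "additive_extension h (\<Sum>x\<in>X. f x) = (\<Sum>x\<in>X. additive_extension h (f x))"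
  by (induction X rule: infinite_finite_induct) (simp_all add: additive_extension_add)

end

lemma additive_extension_mult:
  fixes h :: "'a::comm_monoid_add \<Rightarrow> 'b::comm_semiring_0 \<Rightarrow> 'c::comm_semiring_0"
  assumes h_zero: "\<And>a. h a 0 = 0" and h_add: "\<And>a c d. h a (c + d) = h a c + h a d"
    and h_mult: "\<And>a b c d. h (a + b) (c * d) = h a c * h b d"
  shows "additive_extension h (f * g) = additive_extension h f * additive_extension h g"
proof -
  have "additive_extension h (f * g) = (\<Sum>a\<in>Poly_Mapping.keys f. \<Sum>b\<in>Poly_Mapping.keys g.
      h a (Poly_Mapping.lookup f a) * h b (Poly_Mapping.lookup g b))"
    unfolding mult_sum_single[of f g] additive_extension_sum[of h, OF h_zero h_add]
      additive_extension_single[of h, OF h_zero] h_mult ..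
  then show ?thesis by (simp add: additive_extension_def sum_product)
qed

lemma push_keys_eq: "push_keys f = additive_extension (\<lambda>a. Poly_Mapping.single (f a))"
  by (simp add: fun_eq_iff push_keys_def additive_extension_def)

lemma push_keys_zero [simp]: "push_keys f 0 = 0"
  by (simp add: push_keys_eq)

lemma push_keys_single [simp]: "push_keys f (Poly_Mapping.single a c) = Poly_Mapping.single (f a) c"
  by (simp add: push_keys_eq additive_extension_single)

lemma push_keys_add: "push_keys f (a + b) = push_keys f a + push_keys f b"
  unfolding push_keys_eq by (rule additive_extension_add) (simp_all add: single_add)

lemma push_keys_sum: "push_keys f (\<Sum>x\<in>X. g x) = (\<Sum>x\<in>X. push_keys f (g x))"
  by (induction X rule: infinite_finite_induct) (simp_all add: push_keys_add)

lemma lookup_push_keys: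
  assumes "inj f"
  shows "Poly_Mapping.lookup (push_keys f a) (f i) = Poly_Mapping.lookup a i"
  unfolding push_keys_def
  by (simp add: lookup_sum lookup_single inj_eq[OF assms] when_def in_keys_iff)

lemma lookup_push_keys_outside:
  "i \<notin> range f \<Longrightarrow> Poly_Mapping.lookup (push_keys f a) i = 0"
  unfolding push_keys_def by (auto simp: lookup_sum lookup_single when_def intro!: sum.neutral)

lemma rename_zero [simp]: "rename f 0 = 0"
  by (simp add: rename_def)

lemma rename_add: "rename f (a + b) = rename f a + rename f b"
  by (simp add: rename_def push_keys_add)

lemma rename_sum: "rename f (\<Sum>x\<in>X. g x) = (\<Sum>x\<in>X. rename f (g x))"
  by (simp add: rename_def push_keys_sum)

lemma rename_single [simp]:
  "rename f (Poly_Mapping.single a c) = Poly_Mapping.single (push_keys f a) c"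
  by (simp add: rename_def)

lemma rename_mult: "rename f (a * b) = rename f a * rename f b"
  unfolding rename_def push_keys_eq[of "push_keys f"]
  by (rule additive_extension_mult) (simp_all add: single_add mult_single push_keys_add)

lemma mon_degree_single [simp]: "mon_degree (Poly_Mapping.single i n) = n"
  by (cases "n = 0") (auto simp: mon_degree_def)

lemma mon_degree_zero [simp]: "mon_degree 0 = 0"
  by (simp add: mon_degree_def)

lemma mon_degree_add: "mon_degree (a + b) = mon_degree a + mon_degree b"
  unfolding mon_degree_def using setsum_keys_plus_distrib[of "\<lambda>_ n. n" a b] by simp

lemma mon_degree_eq_zero: "mon_degree a = 0 \<longleftrightarrow> a = 0"
  by (auto simp: mon_degree_def in_keys_iff intro: poly_mapping_eqI)

lemma exponent_add_eq_zero: "a + b = 0 \<longleftrightarrow> a = 0 \<and> b = 0" for a b :: "'x \<Rightarrow>\<^sub>0 nat"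
  by (metis add_is_0 mon_degree_add mon_degree_eq_zero)

lemma lookup_mult_zero:
  "Poly_Mapping.lookup (f * g) 0 = Poly_Mapping.lookup f 0 * Poly_Mapping.lookup g 0"
  for f g :: "('x \<Rightarrow>\<^sub>0 nat) \<Rightarrow>\<^sub>0 'r::comm_ring_1"
proof -
  have "Poly_Mapping.lookup (f * g) 0 = (\<Sum>a\<in>Poly_Mapping.keys f. \<Sum>b\<in>Poly_Mapping.keys g.
      if a = 0 \<and> b = 0 then Poly_Mapping.lookup f 0 * Poly_Mapping.lookup g 0 else 0)"
    unfolding lookup_mult_keys by (intro sum.cong) (auto simp: exponent_add_eq_zero)
  also have "\<dots> = (\<Sum>a\<in>Poly_Mapping.keys f. if a = 0 then
      (\<Sum>b\<in>Poly_Mapping.keys g. if b = 0 then Poly_Mapping.lookup f 0 * Poly_Mapping.lookup g 0 else 0) else 0)"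
    by (intro sum.cong) auto
  also have "\<dots> = Poly_Mapping.lookup f 0 * Poly_Mapping.lookup g 0"
    by (auto simp: in_keys_iff)
  finally show ?thesis .
qed

text \<open>
  Regards a polynomial in the variables \<open>p i\<close> and \<open>q j\<close> as a polynomial in the \<open>q j\<close> whose
  coefficients are polynomials in the \<open>p i\<close>.
\<close>

definition coefs :: "('x \<Rightarrow> 'z) \<Rightarrow> ('y \<Rightarrow> 'z) \<Rightarrow> ('z, 'k) pol \<Rightarrow> ('y, ('x, 'k::comm_ring_1) pol) pol" where
  "coefs p q = additive_extension (\<lambda>c. \<lambda>k. Poly_Mapping.single (Poly_Mapping.map_key q c)
     (Poly_Mapping.single (Poly_Mapping.map_key p c) k))"

locale two_blocks =
  fixes p :: "'x \<Rightarrow> 'z" and q :: "'y \<Rightarrow> 'z"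
  assumes inj_p: "inj p" and inj_q: "inj q"
    and disjoint: "range p \<inter> range q = {}" and covering: "range p \<union> range q = UNIV"
begin

lemma swap: "two_blocks q p"
  using inj_p inj_q disjoint covering by (auto simp: two_blocks_def)

sublocale swapped: two_blocks q p
  by (rule swap)

lemma not_in_range: "p i \<notin> range q" "q j \<notin> range p"
  using disjoint by blast+

lemma map_key_push_keys:
  "Poly_Mapping.map_key p (push_keys p a + push_keys q b) = a"
  "Poly_Mapping.map_key q (push_keys p a + push_keys q b) = b"
  by (auto intro!: poly_mapping_eqI simp: map_key.rep_eq[OF inj_p] map_key.rep_eq[OF inj_q] lookup_add
      lookup_push_keys[OF inj_p] lookup_push_keys[OF inj_q] lookup_push_keys_outside[OF not_in_range(1)]
      lookup_push_keys_outside[OF not_in_range(2)])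

lemma push_keys_map_key:
  "push_keys p (Poly_Mapping.map_key p c) + push_keys q (Poly_Mapping.map_key q c) = c"
proof (rule poly_mapping_eqI)
  fix i
  have "i \<in> range p \<or> i \<in> range q" using covering by blast
  then show "Poly_Mapping.lookup (push_keys p (Poly_Mapping.map_key p c) +
      push_keys q (Poly_Mapping.map_key q c)) i = Poly_Mapping.lookup c i"
    by (auto simp: map_key.rep_eq[OF inj_p] map_key.rep_eq[OF inj_q] lookup_add
      lookup_push_keys[OF inj_p] lookup_push_keys[OF inj_q] lookup_push_keys_outside[OF not_in_range(1)]
      lookup_push_keys_outside[OF not_in_range(2)])
qed

lemma coefs_zero [simp]: "coefs p q 0 = 0"
  by (simp add: coefs_def)

lemma coefs_add: "coefs p q (f + g) = coefs p q f + coefs p q g"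
  unfolding coefs_def by (rule additive_extension_add) (simp_all add: single_add)

lemma coefs_sum: "coefs p q (\<Sum>x\<in>X. f x) = (\<Sum>x\<in>X. coefs p q (f x))"
  by (induction X rule: infinite_finite_induct) (simp_all add: coefs_add)

lemma coefs_diff: "coefs p q (f - g) = coefs p q f - coefs p q g"
  using coefs_add[of "f - g" g] by (simp add: eq_diff_eq)

lemma coefs_mult: "coefs p q (f * g) = coefs p q f * coefs p q g"
  unfolding coefs_def
  by (rule additive_extension_mult)
    (simp_all add: single_add mult_single map_key_plus[OF inj_p] map_key_plus[OF inj_q])

lemma coefs_single: "coefs p q (Poly_Mapping.single c k) =
    Poly_Mapping.single (Poly_Mapping.map_key q c) (Poly_Mapping.single (Poly_Mapping.map_key p c) k)"
  unfolding coefs_def by (rule additive_extension_single) simp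

lemma lookup_coefs:
  "Poly_Mapping.lookup (Poly_Mapping.lookup (coefs p q f) b) a =
   Poly_Mapping.lookup f (push_keys p a + push_keys q b)"
proof -
  have "c = push_keys p a + push_keys q b \<longleftrightarrow>
      Poly_Mapping.map_key q c = b \<and> Poly_Mapping.map_key p c = a" for c
    using map_key_push_keys[of a b] push_keys_map_key[of c] by auto
  then have *: "(if Poly_Mapping.map_key q c = b then
      if Poly_Mapping.map_key p c = a then Poly_Mapping.lookup f c else 0 else 0) =
      (if c = push_keys p a + push_keys q b then Poly_Mapping.lookup f c else 0)" for c
    by simp
  have "Poly_Mapping.lookup (Poly_Mapping.lookup (coefs p q f) b) a = (\<Sum>c\<in>Poly_Mapping.keys f.
      if Poly_Mapping.map_key q c = b then
      if Poly_Mapping.map_key p c = a then Poly_Mapping.lookup f c else 0 else 0)"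
    unfolding coefs_def additive_extension_def
    by (auto simp: lookup_sum lookup_single when_def intro!: sum.cong)
  then show ?thesis unfolding * by (simp add: in_keys_iff)
qed

lemma coefs_inject: "coefs p q f = coefs p q g \<Longrightarrow> f = g"
  by (metis lookup_coefs push_keys_map_key poly_mapping_eqI)

lemma coefs_rename_first: "coefs p q (rename p r) = Poly_Mapping.single 0 r"
  for r :: "('x, 'k::comm_ring_1) pol"
proof -
  have "coefs p q (rename p (Poly_Mapping.single a c)) = Poly_Mapping.single 0 (Poly_Mapping.single a c)"
    for a and c :: 'k
    using map_key_push_keys[of a 0] by (simp add: coefs_single)
  moreover have "(Poly_Mapping.single 0 (\<Sum>x\<in>X. g x) :: ('y, ('x, 'k) pol) pol) =
      (\<Sum>x\<in>X. Poly_Mapping.single 0 (g x))"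
    for X and g :: "('x \<Rightarrow>\<^sub>0 nat) \<Rightarrow> ('x, 'k) pol"
    by (induction X rule: infinite_finite_induct) (simp_all add: single_add)
  ultimately show ?thesis
    by (subst (1 2) poly_mapping_sum_single[of r]) (simp add: rename_sum coefs_sum del: rename_single)
qed

end

context two_blocks
begin

lemma lookup_coefs_rename_second:
  "Poly_Mapping.lookup (coefs p q (rename q v)) b = Poly_Mapping.single 0 (Poly_Mapping.lookup v b)"
proof (rule poly_mapping_eqI)
  fix a
  have "Poly_Mapping.lookup (Poly_Mapping.lookup (coefs p q (rename q v)) b) a =
      Poly_Mapping.lookup (Poly_Mapping.lookup (coefs q p (rename q v)) a) b"
    by (simp add: lookup_coefs swapped.lookup_coefs add.commute)
  also have "\<dots> = Poly_Mapping.lookup (Poly_Mapping.single 0 (Poly_Mapping.lookup v b)) a"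
    by (simp add: swapped.coefs_rename_first lookup_single when_def)
  finally show "Poly_Mapping.lookup (Poly_Mapping.lookup (coefs p q (rename q v)) b) a =
      Poly_Mapping.lookup (Poly_Mapping.single 0 (Poly_Mapping.lookup v b)) a" .
qed

lemma coefs_rename_second_single:
  "coefs p q (rename q (Poly_Mapping.single b c)) = Poly_Mapping.single b (Poly_Mapping.single 0 c)"
  by (rule poly_mapping_eqI)
    (simp add: lookup_coefs_rename_second lookup_single when_def del: rename_single)

lemma coefs_expansion:
  "f = (\<Sum>b\<in>Poly_Mapping.keys (coefs p q f).
     rename p (Poly_Mapping.lookup (coefs p q f) b) * rename q (Poly_Mapping.single b 1))"
proof (rule coefs_inject)
  have "coefs p q f = (\<Sum>b\<in>Poly_Mapping.keys (coefs p q f).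
      Poly_Mapping.single b (Poly_Mapping.lookup (coefs p q f) b))"
    by (rule poly_mapping_sum_single)
  then show "coefs p q f = coefs p q (\<Sum>b\<in>Poly_Mapping.keys (coefs p q f).
     rename p (Poly_Mapping.lookup (coefs p q f) b) * rename q (Poly_Mapping.single b 1))"
    by (simp add: coefs_sum coefs_mult coefs_rename_first coefs_rename_second_single mult_single
        del: rename_single)
qed

end

lemma rename_one [simp]: "rename f 1 = 1"
  using rename_single[of f 0 1] by simp

lemma rename_ideal_pow:
  assumes "rename f ` K \<subseteq> L" "a \<in> ideal_pow K n"
  shows "rename f a \<in> ideal_pow L n"
proof -
  have "ideal_pow K n \<subseteq> {a. rename f a \<in> ideal_pow L n}"
  proof (induction n)
    case (Suc n)
    show ?case unfolding ideal_pow.simps(2)[of K]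
    proof (rule ideal_prod_least)
      show "is_ideal {a. rename f a \<in> ideal_pow L (Suc n)}"
        using is_ideal_ideal_pow[of L "Suc n"]
        by (auto simp: is_ideal_iff rename_add rename_mult simp del: ideal_pow.simps)
      show "a * b \<in> {a. rename f a \<in> ideal_pow L (Suc n)}" if "a \<in> K" "b \<in> ideal_pow K n" for a b
        using that Suc assms(1) by (auto simp: rename_mult intro!: ideal_prod_mem)
    qed
  qed simp
  with assms(2) show ?thesis by blast
qed


section \<open>Powers of the maximal ideal and filtrations by degree\<close>

lemma exponent_cases:
  fixes b :: "'x \<Rightarrow>\<^sub>0 nat"
  obtains "b = 0" | i b' where "b = Poly_Mapping.single i 1 + b'"
proof (cases "b = 0")
  case False
  then obtain i where "Poly_Mapping.lookup b i \<noteq> 0"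
    by (metis lookup_zero poly_mapping_eqI)
  then have "b = Poly_Mapping.single i 1 + (b - Poly_Mapping.single i 1)"
    by (intro poly_mapping_eqI) (auto simp: lookup_add lookup_minus lookup_single when_def)
  with that show thesis by blast
qed

lemma single_mem_max_ideal_pow:
  "n \<le> mon_degree b \<Longrightarrow> Poly_Mapping.single b c \<in> ideal_pow max_ideal n"
proof (induction n arbitrary: b)
  case (Suc n)
  then obtain i b' where b: "b = Poly_Mapping.single i 1 + b'"
    by (cases b rule: exponent_cases) auto
  have "var i \<in> max_ideal"
    unfolding max_ideal_def by (rule subsetD[OF gen_ideal_superset]) simp
  moreover have "Poly_Mapping.single b' c \<in> ideal_pow max_ideal n"
    using Suc by (simp add: b mon_degree_add)
  ultimately have "var i * Poly_Mapping.single b' c \<in> ideal_pow max_ideal (Suc n)"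
    by (rule ideal_pow_Suc_mem)
  then show ?case by (simp add: var_def mult_single b)
qed simp

lemma is_ideal_order_ge: "is_ideal {f :: ('x, 'k::comm_ring_1) pol. \<forall>b\<in>Poly_Mapping.keys f. n \<le> mon_degree b}"
proof (rule is_idealI)
  fix f g :: "('x, 'k) pol"
  assume "f \<in> {f. \<forall>b\<in>Poly_Mapping.keys f. n \<le> mon_degree b}"
    and "g \<in> {f. \<forall>b\<in>Poly_Mapping.keys f. n \<le> mon_degree b}"
  then show "f + g \<in> {f. \<forall>b\<in>Poly_Mapping.keys f. n \<le> mon_degree b}"
    using keys_add[of f g] by auto
next
  fix r f :: "('x, 'k) pol"
  assume "f \<in> {f. \<forall>b\<in>Poly_Mapping.keys f. n \<le> mon_degree b}"
  then show "r * f \<in> {f. \<forall>b\<in>Poly_Mapping.keys f. n \<le> mon_degree b}"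
    using keys_mult[of r f] by (fastforce simp: mon_degree_add)
qed simp

lemma max_ideal_order: "max_ideal \<subseteq> {f. \<forall>b\<in>Poly_Mapping.keys f. 1 \<le> mon_degree b}"
  unfolding max_ideal_def by (rule gen_ideal_minimal[OF _ is_ideal_order_ge]) (auto simp: var_def)

lemma max_ideal_pow_iff:
  "f \<in> ideal_pow max_ideal n \<longleftrightarrow> (\<forall>b\<in>Poly_Mapping.keys f. n \<le> mon_degree b)"
proof
  assume "\<forall>b\<in>Poly_Mapping.keys f. n \<le> mon_degree b"
  then have "(\<Sum>b\<in>Poly_Mapping.keys f. Poly_Mapping.single b (Poly_Mapping.lookup f b)) \<in> ideal_pow max_ideal n"
    by (intro ideal_sum is_ideal_ideal_pow single_mem_max_ideal_pow) auto
  then show "f \<in> ideal_pow max_ideal n" by (simp flip: poly_mapping_sum_single)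
next
  have "ideal_pow max_ideal n \<subseteq> {f :: ('a, 'b) pol. \<forall>b\<in>Poly_Mapping.keys f. n \<le> mon_degree b}"
  proof (induction n)
    case (Suc n)
    show ?case unfolding ideal_pow.simps(2)
    proof (rule ideal_prod_least[OF is_ideal_order_ge])
      fix f g :: "('a, 'b) pol" assume "f \<in> max_ideal" "g \<in> ideal_pow max_ideal n"
      then have "\<forall>b\<in>Poly_Mapping.keys f. 1 \<le> mon_degree b" "\<forall>b\<in>Poly_Mapping.keys g. n \<le> mon_degree b"
        using Suc max_ideal_order by blast+
      then show "f * g \<in> {f. \<forall>b\<in>Poly_Mapping.keys f. Suc n \<le> mon_degree b}"
        using keys_mult[of f g] by (fastforce simp: mon_degree_add)
    qed
  qed simp
  then show "f \<in> ideal_pow max_ideal n \<Longrightarrow> \<forall>b\<in>Poly_Mapping.keys f. n \<le> mon_degree b" by blast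
qed

lemma is_ideal_max_ideal: "is_ideal max_ideal"
  unfolding max_ideal_def by (rule is_ideal_gen_ideal)

lemma max_ideal_iff: "f \<in> max_ideal \<longleftrightarrow> Poly_Mapping.lookup f 0 = 0"
proof -
  have *: "Suc 0 \<le> mon_degree b \<longleftrightarrow> b \<noteq> 0" for b :: "'a \<Rightarrow>\<^sub>0 nat"
    using mon_degree_eq_zero[of b] by linarith
  have "f \<in> max_ideal \<longleftrightarrow> (\<forall>b\<in>Poly_Mapping.keys f. Suc 0 \<le> mon_degree b)"
    using max_ideal_pow_iff[of f "Suc 0"] by (simp only: ideal_pow_one[OF is_ideal_max_ideal])
  then show ?thesis unfolding * by (auto simp: in_keys_iff)
qed

definition coef_filtration :: "(nat \<Rightarrow> 'r set) \<Rightarrow> nat \<Rightarrow> ('y, 'r::comm_ring_1) pol set" where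
  "coef_filtration K s = {f. \<forall>b. Poly_Mapping.lookup f b \<in> K (s - mon_degree b)}"

context
  fixes K :: "nat \<Rightarrow> 'r::comm_ring_1 set"
  assumes ideals: "\<And>n. is_ideal (K n)" and anti: "\<And>m n. m \<le> n \<Longrightarrow> K n \<subseteq> K m"
begin

lemma is_ideal_coef_filtration: "is_ideal (coef_filtration K s)"
proof (rule is_idealI)
  fix f g :: "('y, 'r) pol" assume f: "f \<in> coef_filtration K s"
  have "Poly_Mapping.lookup f b \<in> K (s - mon_degree (a + b))" for a b
    using f subsetD[OF anti, of "s - mon_degree (a + b)" "s - mon_degree b"]
    by (simp add: coef_filtration_def mon_degree_add)
  then show "g * f \<in> coef_filtration K s"
    by (auto simp: coef_filtration_def lookup_mult_keys
        intro!: ideal_sum ideals ideal_mult_left[OF ideals] ideal_zero[OF ideals])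
qed (auto simp: coef_filtration_def lookup_add intro: ideal_zero[OF ideals] ideal_add[OF ideals])

lemma coef_filtration_mult:
  assumes mult: "\<And>m n a b. a \<in> K m \<Longrightarrow> b \<in> K n \<Longrightarrow> a * b \<in> K (m + n)"
    and f: "f \<in> coef_filtration K s" and g: "g \<in> coef_filtration K t"
  shows "f * g \<in> coef_filtration K (s + t)"
proof -
  have "Poly_Mapping.lookup f a * Poly_Mapping.lookup g b \<in> K (s + t - mon_degree (a + b))" for a b
  proof -
    have "Poly_Mapping.lookup f a * Poly_Mapping.lookup g b \<in> K ((s - mon_degree a) + (t - mon_degree b))"
      using f g by (intro mult) (auto simp: coef_filtration_def)
    moreover have "s + t - mon_degree (a + b) \<le> (s - mon_degree a) + (t - mon_degree b)"
      by (simp add: mon_degree_add)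
    ultimately show ?thesis by (rule subsetD[OF anti, rotated])
  qed
  then show ?thesis
    by (auto simp: coef_filtration_def lookup_mult_keys intro!: ideal_sum ideals ideal_zero[OF ideals])
qed

text \<open>
  Modulo coefficients already known to lie in the saturation, the lowest coefficient of
  \<open>u * f\<close> is the constant coefficient of \<open>u\<close> times the lowest coefficient of \<open>f\<close>.
\<close>

lemma coef_filtration_saturation:
  assumes P: "prime_ideal P" and u: "Poly_Mapping.lookup u 0 \<notin> P" and uf: "u * f \<in> coef_filtration K s"
  shows "f \<in> coef_filtration (\<lambda>n. saturation P (K n)) s"
proof -
  define L where "L n = saturation P (K n)" for n
  have L: "is_ideal (L n)" for n unfolding L_def by (rule is_ideal_saturation[OF P ideals])
  have KL: "K n \<subseteq> L n" for n unfolding L_def by (rule saturation_superset[OF P])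
  have L_anti: "L n \<subseteq> L m" if "m \<le> n" for m n
    unfolding L_def by (rule saturation_mono[OF anti[OF that]])
  define u' where "u' = u - Poly_Mapping.single 0 (Poly_Mapping.lookup u 0)"
  have u': "a \<noteq> 0" if "a \<in> Poly_Mapping.keys u'" for a
    using that by (auto simp: u'_def in_keys_iff lookup_minus)
  have "Poly_Mapping.lookup f b \<in> L (s - mon_degree b)" for b
  proof (induction "mon_degree b" arbitrary: b rule: less_induct)
    case less
    have "Poly_Mapping.lookup u' a * Poly_Mapping.lookup f c \<in> L (s - mon_degree b)"
      if "a \<in> Poly_Mapping.keys u'" "a + c = b" for a c
    proof -
      have "mon_degree c < mon_degree b"
        using that(2) u'[OF that(1)] mon_degree_eq_zero[of a] by (auto simp: mon_degree_add)
      then have "Poly_Mapping.lookup f c \<in> L (s - mon_degree b)"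
        using less[of c] subsetD[OF L_anti, of "s - mon_degree b" "s - mon_degree c"] by auto
      then show ?thesis by (rule ideal_mult_left[OF L])
    qed
    then have 1: "Poly_Mapping.lookup (u' * f) b \<in> L (s - mon_degree b)"
      unfolding lookup_mult_keys by (auto intro!: ideal_sum L ideal_zero[OF L])
    have 2: "Poly_Mapping.lookup (u * f) b \<in> L (s - mon_degree b)"
      using uf KL by (auto simp: coef_filtration_def)
    have "u = u' + Poly_Mapping.single 0 (Poly_Mapping.lookup u 0)" by (simp add: u'_def)
    then have "Poly_Mapping.lookup (u * f) b =
        Poly_Mapping.lookup (u' * f) b + Poly_Mapping.lookup u 0 * Poly_Mapping.lookup f b"
      by (metis distrib_right lookup_add lookup_single_zero_mult)
    then have "Poly_Mapping.lookup u 0 * Poly_Mapping.lookup f b \<in> L (s - mon_degree b)"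
      using ideal_diff[OF L 2 1] by simp
    then show ?case unfolding L_def by (rule saturation_cancel[OF P u])
  qed
  then show ?thesis by (simp add: coef_filtration_def L_def)
qed

end

context two_blocks
begin

lemma is_ideal_coefs_vimage:
  assumes "is_ideal M"
  shows "is_ideal {f. coefs p q f \<in> M}"
  using assms by (auto simp: is_ideal_iff coefs_add coefs_mult)

lemma ideal_pow_coef_filtration:
  assumes K: "is_ideal K" and F: "\<And>f. f \<in> F \<Longrightarrow> Poly_Mapping.lookup (coefs p q f) 0 \<in> K"
  shows "ideal_pow F s \<subseteq> {f. coefs p q f \<in> coef_filtration (ideal_pow K) s}"
proof (induction s)
  case 0
  then show ?case by (simp add: coef_filtration_def)
next
  case (Suc s)
  have F1: "coefs p q f \<in> coef_filtration (ideal_pow K) 1" if "f \<in> F" for f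
  proof -
    have "Poly_Mapping.lookup (coefs p q f) b \<in> ideal_pow K (1 - mon_degree b)" for b
    proof (cases "b = 0")
      case False
      then have "1 - mon_degree b = 0" using mon_degree_eq_zero[of b] by simp
      then show ?thesis by simp
    qed (use F[OF that] ideal_pow_one[OF K] in \<open>simp del: ideal_pow.simps\<close>)
    then show ?thesis by (simp add: coef_filtration_def)
  qed
  show ?case unfolding ideal_pow.simps(2)
  proof (rule ideal_prod_least)
    show "is_ideal {f. coefs p q f \<in> coef_filtration (ideal_pow K) (Suc s)}"
      by (intro is_ideal_coefs_vimage is_ideal_coef_filtration is_ideal_ideal_pow ideal_pow_antimono)
    fix f g assume "f \<in> F" "g \<in> ideal_pow F s"
    then have "coefs p q f * coefs p q g \<in> coef_filtration (ideal_pow K) (1 + s)"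
      using Suc F1
      by (intro coef_filtration_mult is_ideal_ideal_pow ideal_pow_antimono ideal_pow_mult) auto
    then show "f * g \<in> {f. coefs p q f \<in> coef_filtration (ideal_pow K) (Suc s)}"
      by (simp add: coefs_mult)
  qed
qed

lemma monomial_mem_ideal_pow:
  fixes x g :: "('x, 'k::comm_ring_1) pol"
  assumes "rename p ` K \<subseteq> F" and x: "\<And>j. rename p x * rename q (var j) \<in> F"
    and "g \<in> ideal_pow K (s - mon_degree b)"
  shows "rename p (x ^ s * g) * rename q (Poly_Mapping.single b 1) \<in> ideal_pow F s"
  using assms(3)
proof (induction s arbitrary: b)
  case (Suc s)
  show ?case
  proof (cases b rule: exponent_cases)
    case 1
    have "rename p g \<in> ideal_pow F (Suc s)"
      using Suc.prems 1 by (intro rename_ideal_pow[OF assms(1)]) simp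
    then show ?thesis
      using ideal_mult_left[OF is_ideal_ideal_pow, of "rename p g" F "Suc s" "rename p (x ^ Suc s)"] 1
      by (simp add: rename_mult)
  next
    case (2 j b')
    have "(rename p x * rename q (var j)) * (rename p (x ^ s * g) * rename q (Poly_Mapping.single b' 1))
        \<in> ideal_pow F (Suc s)"
      using Suc.prems 2 by (intro ideal_pow_Suc_mem x Suc.IH) (simp add: mon_degree_add)
    moreover have "var j * Poly_Mapping.single b' 1 = Poly_Mapping.single b (1 :: 'k)"
      unfolding 2 by (simp add: var_def mult_single)
    then have "rename p (x ^ Suc s * g) * rename q (Poly_Mapping.single b 1) =
        rename p (x * (x ^ s * g)) * rename q (var j * Poly_Mapping.single b' 1)"
      by (simp only: power_Suc mult.assoc)
    then have "rename p (x ^ Suc s * g) * rename q (Poly_Mapping.single b 1) =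
        (rename p x * rename q (var j)) * (rename p (x ^ s * g) * rename q (Poly_Mapping.single b' 1))"
      unfolding rename_mult[of _ x] rename_mult[of _ "var j"] by (simp only: mult_ac)
    ultimately show ?thesis by (simp only:)
  qed
qed simp

lemma saturation_ideal_pow:
  assumes P: "prime_ideal P" and K: "is_ideal K"
    and F: "\<And>f. f \<in> F \<Longrightarrow> Poly_Mapping.lookup (coefs p q f) 0 \<in> K" and KF: "rename p ` K \<subseteq> F"
    and x: "\<And>j. rename p x * rename q (var j) \<in> F" "x \<notin> P"
  shows "saturation {f. Poly_Mapping.lookup (coefs p q f) 0 \<in> P} (ideal_pow F s) =
    {f. \<forall>b. Poly_Mapping.lookup (coefs p q f) b \<in> saturation P (ideal_pow K (s - mon_degree b))}"
proof (intro equalityI subsetI)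
  fix f assume "f \<in> saturation {f. Poly_Mapping.lookup (coefs p q f) 0 \<in> P} (ideal_pow F s)"
  then obtain u where u: "Poly_Mapping.lookup (coefs p q u) 0 \<notin> P" "u * f \<in> ideal_pow F s"
    by (auto simp: saturation_def)
  then have "coefs p q u * coefs p q f \<in> coef_filtration (ideal_pow K) s"
    using ideal_pow_coef_filtration[OF K F, of F s] by (auto simp: coefs_mult)
  from coef_filtration_saturation[OF is_ideal_ideal_pow ideal_pow_antimono P u(1) this]
  show "f \<in> {f. \<forall>b. Poly_Mapping.lookup (coefs p q f) b \<in> saturation P (ideal_pow K (s - mon_degree b))}"
    by (simp add: coef_filtration_def)
next
  fix f assume "f \<in> {f. \<forall>b. Poly_Mapping.lookup (coefs p q f) b \<in> saturation P (ideal_pow K (s - mon_degree b))}"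
  then obtain u where u: "u \<notin> P"
    "\<And>b. b \<in> Poly_Mapping.keys (coefs p q f) \<Longrightarrow>
      u * Poly_Mapping.lookup (coefs p q f) b \<in> ideal_pow K (s - mon_degree b)"
    using saturation_common_denominator[OF P, of "Poly_Mapping.keys (coefs p q f)"
        "\<lambda>b. ideal_pow K (s - mon_degree b)" "Poly_Mapping.lookup (coefs p q f)"]
    by (auto simp: is_ideal_ideal_pow)
  have "rename p (x ^ s * u) * f = rename p (x ^ s * u) * (\<Sum>b\<in>Poly_Mapping.keys (coefs p q f).
      rename p (Poly_Mapping.lookup (coefs p q f) b) * rename q (Poly_Mapping.single b 1))"
    using coefs_expansion[of f] by simp
  also have "\<dots> = (\<Sum>b\<in>Poly_Mapping.keys (coefs p q f).
      rename p (x ^ s * (u * Poly_Mapping.lookup (coefs p q f) b)) * rename q (Poly_Mapping.single b 1))"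
    by (simp add: sum_distrib_left rename_mult mult_ac del: rename_single)
  also have "\<dots> \<in> ideal_pow F s"
    using u(2) by (intro ideal_sum is_ideal_ideal_pow monomial_mem_ideal_pow[OF KF x(1)])
  finally have "rename p (x ^ s * u) * f \<in> ideal_pow F s" .
  moreover have "x ^ s * u \<notin> P"
    using u(1) prime_ideal_power[OF P x(2)] prime_ideal_mult[OF P] by blast
  ultimately show "f \<in> saturation {f. Poly_Mapping.lookup (coefs p q f) 0 \<in> P} (ideal_pow F s)"
    by (auto simp: saturation_def coefs_rename_first intro!: exI[of _ "rename p (x ^ s * u)"])
qed

end


section \<open>Symbolic powers of a fiber product\<close>

lemma mon_degree_push_keys [simp]: "mon_degree (push_keys f a) = mon_degree a"
  for f :: "'a \<Rightarrow> 'b"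
proof -
  have "mon_degree (\<Sum>i\<in>X. g i) = (\<Sum>i\<in>X. mon_degree (g i))" for X :: "'a set" and g :: "'a \<Rightarrow> 'b \<Rightarrow>\<^sub>0 nat"
    by (induction X rule: infinite_finite_induct) (simp_all add: mon_degree_add)
  then show ?thesis by (simp add: push_keys_def mon_degree_def[of a])
qed

context two_blocks
begin

lemma lookup_coefs_rename_mult:
  "Poly_Mapping.lookup (coefs p q (rename p u * rename q v)) b =
   u * Poly_Mapping.single 0 (Poly_Mapping.lookup v b)"
  by (simp add: coefs_mult coefs_rename_first lookup_single_zero_mult lookup_coefs_rename_second)

lemma coefs_rename_mult_mem:
  assumes K: "\<And>n. is_ideal (K n)" "\<And>m n. m \<le> n \<Longrightarrow> K n \<subseteq> K m"
    and u: "u \<in> K i" and v: "\<And>b. b \<in> Poly_Mapping.keys v \<Longrightarrow> s - mon_degree b \<le> i"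
  shows "coefs p q (rename p u * rename q v) \<in> coef_filtration K s"
proof -
  have "u * Poly_Mapping.single 0 (Poly_Mapping.lookup v b) \<in> K (s - mon_degree b)" for b
  proof (cases "b \<in> Poly_Mapping.keys v")
    case True
    from subsetD[OF K(2)[OF v[OF True]] u] show ?thesis by (rule ideal_mult_right[OF K(1)])
  qed (simp add: in_keys_iff ideal_zero[OF K(1)])
  then show ?thesis by (simp add: coef_filtration_def lookup_coefs_rename_mult)
qed

end

context two_blocks
begin

text \<open>
  Gaussian elimination on the matrix of coefficients: the pivot is an entry of minimal total
  degree, and subtracting the rank-one matrix spanned by its row and its column clears that
  column without filling any zero column. Minimality puts the row and the column into the
  required powers of the maximal ideals.
\<close>

lemma rank_one_decomposition:
  fixes f :: "('z, 'k::field) pol"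
  assumes K: "\<And>n. is_ideal (K n)" "\<And>m n. m \<le> n \<Longrightarrow> K n \<subseteq> K m"
    and L: "\<And>n. is_ideal (L n)" "\<And>m n. m \<le> n \<Longrightarrow> L n \<subseteq> L m"
    and G: "is_ideal G"
    and KLG: "\<And>i t u v. i \<le> s \<Longrightarrow> t \<le> s \<Longrightarrow> u \<in> K i \<inter> ideal_pow max_ideal (s - t) \<Longrightarrow>
      v \<in> L t \<inter> ideal_pow max_ideal (s - i) \<Longrightarrow> rename p u * rename q v \<in> G"
    and "coefs p q f \<in> coef_filtration K s" "coefs q p f \<in> coef_filtration L s"
  shows "f \<in> G"
  using assms(7,8)
proof (induction "card (Poly_Mapping.keys (coefs p q f))" arbitrary: f rule: less_induct)
  case less
  show ?case
  proof (cases "f = 0")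
    case True
    then show ?thesis by (simp add: ideal_zero[OF G])
  next
    case False
    then obtain c where "c \<in> Poly_Mapping.keys f"
      by (metis keys_eq_empty ex_in_conv)
    then obtain c0 where c0: "c0 \<in> Poly_Mapping.keys f"
      and least: "\<And>c. c \<in> Poly_Mapping.keys f \<Longrightarrow> mon_degree c0 \<le> mon_degree c"
      using ex_has_least_nat[of "\<lambda>c. c \<in> Poly_Mapping.keys f" c mon_degree] by blast
    define a0 where "a0 = Poly_Mapping.map_key p c0"
    define b0 where "b0 = Poly_Mapping.map_key q c0"
    have c0_eq: "c0 = push_keys p a0 + push_keys q b0"
      unfolding a0_def b0_def by (simp add: push_keys_map_key)
    define k where "k = Poly_Mapping.lookup f c0"
    have k: "k \<noteq> 0" using c0 by (simp add: k_def in_keys_iff)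
    define u where "u = Poly_Mapping.lookup (coefs p q f) b0"
    define v where "v = Poly_Mapping.lookup (coefs q p f) a0"
    have lookup_v: "Poly_Mapping.lookup v b = Poly_Mapping.lookup (Poly_Mapping.lookup (coefs p q f) b) a0" for b
      by (simp add: v_def swapped.lookup_coefs lookup_coefs add.commute)
    have lookup_u: "Poly_Mapping.lookup u a0 = k"
      by (simp add: u_def lookup_coefs k_def c0_eq)
    have u_order: "mon_degree a0 \<le> mon_degree a" if "a \<in> Poly_Mapping.keys u" for a
      using that least[of "push_keys p a + push_keys q b0"]
      by (simp add: u_def in_keys_iff lookup_coefs c0_eq mon_degree_add)
    have v_order: "mon_degree b0 \<le> mon_degree b" if "b \<in> Poly_Mapping.keys v" for b
      using that least[of "push_keys p a0 + push_keys q b"]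
      by (simp add: lookup_v in_keys_iff lookup_coefs c0_eq mon_degree_add)
    define u' where "u' = Poly_Mapping.single 0 (inverse k) * u"
    have keys_u': "Poly_Mapping.keys u' \<subseteq> Poly_Mapping.keys u"
      by (auto simp: u'_def in_keys_iff lookup_single_zero_mult)
    have u': "u' \<in> K (s - mon_degree b0)"
      unfolding u'_def u_def using less.prems(1)
      by (intro ideal_mult_left[OF K(1)]) (simp add: coef_filtration_def)
    have v: "v \<in> L (s - mon_degree a0)"
      unfolding v_def using less.prems(2) by (simp add: coef_filtration_def)
    define g where "g = rename p u' * rename q v"
    have "g \<in> G" unfolding g_def
    proof (rule KLG)
      show "u' \<in> K (s - mon_degree b0) \<inter> ideal_pow max_ideal (s - (s - mon_degree a0))"
        using u' u_order keys_u' by (force simp: max_ideal_pow_iff)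
      show "v \<in> L (s - mon_degree a0) \<inter> ideal_pow max_ideal (s - (s - mon_degree b0))"
        using v v_order by (force simp: max_ideal_pow_iff)
    qed simp_all
    have g1: "coefs p q g \<in> coef_filtration K s" unfolding g_def
      by (rule coefs_rename_mult_mem[of K, OF K u']) (auto intro: diff_le_mono2 v_order)
    have g2: "coefs q p g \<in> coef_filtration L s" unfolding g_def mult.commute[of "rename p u'"]
      by (rule swapped.coefs_rename_mult_mem[of L, OF L v]) (use keys_u' u_order in \<open>auto intro: diff_le_mono2\<close>)
    have column: "Poly_Mapping.lookup (coefs p q g) b =
        Poly_Mapping.single 0 (inverse k * Poly_Mapping.lookup v b) * u" for b
      unfolding g_def lookup_coefs_rename_mult u'_def
      by (simp add: mult_single mult_ac flip: mult.assoc[of "Poly_Mapping.single 0 _" "Poly_Mapping.single 0 _"])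
    have "Poly_Mapping.lookup (coefs p q (f - g)) b0 = 0"
      using k lookup_u by (simp add: coefs_diff lookup_minus column lookup_v flip: u_def)
    moreover have "Poly_Mapping.lookup (coefs p q (f - g)) b = 0"
      if "Poly_Mapping.lookup (coefs p q f) b = 0" for b
      using that by (simp add: coefs_diff lookup_minus column lookup_v)
    ultimately have "Poly_Mapping.keys (coefs p q (f - g)) \<subseteq> Poly_Mapping.keys (coefs p q f) - {b0}"
      by (auto simp: in_keys_iff)
    moreover have "b0 \<in> Poly_Mapping.keys (coefs p q f)"
      using k lookup_coefs[of f b0 a0] by (auto simp: in_keys_iff k_def c0_eq)
    ultimately have "card (Poly_Mapping.keys (coefs p q (f - g))) < card (Poly_Mapping.keys (coefs p q f))"
      by (intro psubset_card_mono) auto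
    moreover have "coefs p q (f - g) \<in> coef_filtration K s" "coefs q p (f - g) \<in> coef_filtration L s"
      unfolding coefs_diff swapped.coefs_diff
      using ideal_diff[OF is_ideal_coef_filtration[of K, OF K] less.prems(1) g1]
        ideal_diff[OF is_ideal_coef_filtration[of L, OF L] less.prems(2) g2] by simp_all
    ultimately have "f - g \<in> G" by (rule less.hyps)
    from ideal_add[OF G this \<open>g \<in> G\<close>] show ?thesis by simp
  qed
qed

lemma is_ideal_evaluation_vimage:
  "is_ideal P \<Longrightarrow> is_ideal {f. Poly_Mapping.lookup (coefs p q f) 0 \<in> P}"
  by (auto simp: is_ideal_iff coefs_add coefs_mult lookup_add lookup_mult_zero)

lemma evaluation_rename:
  "Poly_Mapping.lookup (coefs p q (rename p r)) 0 = r"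
  "v \<in> max_ideal \<Longrightarrow> Poly_Mapping.lookup (coefs p q (rename q v)) 0 = 0"
  by (simp_all add: coefs_rename_first lookup_coefs_rename_second max_ideal_iff)

end

context two_blocks
begin

lemma fiber_product_ideal:
  fixes I :: "('x, 'k::comm_ring_1) pol set" and J :: "('y, 'k) pol set"
  assumes I: "is_ideal I" "I \<subseteq> max_ideal" and J: "is_ideal J" "J \<subseteq> max_ideal"
  shows "extend p I + extend q J + ideal_prod (extend p max_ideal) (extend q max_ideal) =
    {f. Poly_Mapping.lookup (coefs p q f) 0 \<in> I \<and> Poly_Mapping.lookup (coefs q p f) 0 \<in> J}"
    (is "?F = ?E")
proof (intro equalityI subsetI)
  have E: "is_ideal ?E"
    using is_ideal_evaluation_vimage[OF I(1)] swapped.is_ideal_evaluation_vimage[OF J(1)]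
    by (simp add: is_ideal_iff)
  have "extend p I \<subseteq> ?E" "extend q J \<subseteq> ?E"
    unfolding extend_def using I J
    by (intro gen_ideal_minimal[OF _ E];
      auto simp: evaluation_rename swapped.evaluation_rename ideal_zero subset_iff)+
  moreover have "ideal_prod (extend p max_ideal) (extend q max_ideal) \<subseteq> ?E"
    unfolding extend_def
    by (rule gen_ideal_prod_least[OF E])
      (auto simp: coefs_mult swapped.coefs_mult lookup_mult_zero evaluation_rename
        swapped.evaluation_rename ideal_zero I J)
  ultimately have "?F \<subseteq> ?E"
    by (intro set_plus_least[OF E])
  then show "f \<in> ?F \<Longrightarrow> f \<in> ?E" for f by blast
next
  fix f assume f: "f \<in> ?E"
  define r where "r = Poly_Mapping.lookup (coefs p q f) 0"
  define v where "v = Poly_Mapping.lookup (coefs q p f) 0"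
  define h where "h = f - rename p r - rename q v"
  have r: "r \<in> I" "r \<in> max_ideal" and v: "v \<in> J" "v \<in> max_ideal"
    using f I(2) J(2) by (auto simp: r_def v_def)
  have h0: "Poly_Mapping.lookup (coefs p q h) 0 = 0" "Poly_Mapping.lookup (coefs q p h) 0 = 0"
    using r v unfolding h_def
    by (simp_all add: coefs_diff swapped.coefs_diff lookup_minus evaluation_rename
        swapped.evaluation_rename r_def v_def)
  have "Poly_Mapping.single c k \<in> ideal_prod (extend p max_ideal) (extend q max_ideal)"
    if c: "c \<in> Poly_Mapping.keys h" for c k
  proof -
    define a where "a = Poly_Mapping.map_key p c"
    define b where "b = Poly_Mapping.map_key q c"
    have c_eq: "c = push_keys p a + push_keys q b"
      unfolding a_def b_def by (simp add: push_keys_map_key)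
    have "a \<noteq> 0" "b \<noteq> 0"
      using c h0 lookup_coefs[of h b a] swapped.lookup_coefs[of h a b]
      by (auto simp: in_keys_iff c_eq add.commute)
    then have "rename p (Poly_Mapping.single a k) \<in> extend p max_ideal"
      "rename q (Poly_Mapping.single b 1) \<in> extend q max_ideal"
      unfolding extend_def
      by (auto simp: max_ideal_iff lookup_single when_def simp del: rename_single
          intro!: subsetD[OF gen_ideal_superset])
    from ideal_prod_mem[OF this] show ?thesis by (simp add: mult_single c_eq)
  qed
  then have "(\<Sum>c\<in>Poly_Mapping.keys h. Poly_Mapping.single c (Poly_Mapping.lookup h c))
      \<in> ideal_prod (extend p max_ideal) (extend q max_ideal)"
    by (intro ideal_sum is_ideal_ideal_prod)
  then have "h \<in> ideal_prod (extend p max_ideal) (extend q max_ideal)"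
    by (simp flip: poly_mapping_sum_single)
  moreover have "rename p r \<in> extend p I" "rename q v \<in> extend q J"
    unfolding extend_def using r v by (auto intro!: subsetD[OF gen_ideal_superset])
  ultimately have "rename p r + rename q v + h \<in> ?F"
    by (intro set_plus_intro)
  then show "f \<in> ?F" by (simp add: h_def)
qed

lemma prime_ideal_evaluation_vimage:
  fixes P :: "('x, 'k::comm_ring_1) pol set"
  assumes "prime_ideal P"
  shows "prime_ideal {f. Poly_Mapping.lookup (coefs p q f) 0 \<in> P}"
  using is_ideal_evaluation_vimage[OF prime_ideal_ideal[OF assms]] prime_ideal_mult[OF assms]
    prime_ideal_one[OF assms] evaluation_rename(1)[of "1 :: ('x, 'k) pol"]
  unfolding prime_ideal_def by (auto simp: coefs_mult lookup_mult_zero set_eq_iff intro!: exI[of _ 1])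

lemma assoc_prime_evaluation_vimage:
  fixes I :: "('x, 'k::comm_ring_1) pol set" and J :: "('y, 'k) pol set"
  assumes P: "P \<in> assoc_primes I" and J: "is_ideal J"
    and x: "x \<in> max_ideal" "\<And>a. x * a \<in> I \<Longrightarrow> a \<in> I" and I: "is_ideal I"
  shows "{f. Poly_Mapping.lookup (coefs p q f) 0 \<in> P} \<in>
    assoc_primes {f. Poly_Mapping.lookup (coefs p q f) 0 \<in> I \<and> Poly_Mapping.lookup (coefs q p f) 0 \<in> J}"
proof -
  from P obtain a where prime: "prime_ideal P" and a: "P = {r. r * a \<in> I}"
    by (auto simp: assoc_primes_def)
  have "x * a \<in> max_ideal" by (rule ideal_mult_right[OF is_ideal_max_ideal x(1)])
  moreover have "r * (x * a) \<in> I \<longleftrightarrow> r * a \<in> I" for r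
    using x(2)[of "r * a"] ideal_mult_left[OF I, of "r * a" x] by (auto simp: mult.left_commute)
  ultimately have "{f. Poly_Mapping.lookup (coefs p q f) 0 \<in> P} = {f. f * rename p (x * a) \<in>
      {f. Poly_Mapping.lookup (coefs p q f) 0 \<in> I \<and> Poly_Mapping.lookup (coefs q p f) 0 \<in> J}}"
    by (simp add: a coefs_mult swapped.coefs_mult lookup_mult_zero evaluation_rename
        swapped.evaluation_rename ideal_zero[OF J])
  then show ?thesis
    unfolding assoc_primes_def using prime_ideal_evaluation_vimage[OF prime] by blast
qed

lemma assoc_prime_containing_second:
  fixes I :: "('x, 'k::comm_ring_1) pol set" and J :: "('y, 'k) pol set"
  assumes P: "P \<in> assoc_primes
      {f. Poly_Mapping.lookup (coefs p q f) 0 \<in> I \<and> Poly_Mapping.lookup (coefs q p f) 0 \<in> J}"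
    and J: "is_ideal J" and z: "z \<in> max_ideal" "\<And>a. z * a \<in> J \<Longrightarrow> a \<in> J" and zP: "rename q z \<in> P"
  shows "\<exists>Q\<in>assoc_primes I. P = {f. Poly_Mapping.lookup (coefs p q f) 0 \<in> Q}"
proof -
  from P obtain c where prime: "prime_ideal P" and c: "P = {f. f * c \<in>
      {f. Poly_Mapping.lookup (coefs p q f) 0 \<in> I \<and> Poly_Mapping.lookup (coefs q p f) 0 \<in> J}}"
    by (auto simp: assoc_primes_def)
  have "z * Poly_Mapping.lookup (coefs q p c) 0 \<in> J"
    using zP unfolding c by (simp add: swapped.coefs_mult lookup_mult_zero swapped.evaluation_rename)
  then have "Poly_Mapping.lookup (coefs q p c) 0 \<in> J" by (rule z(2))
  then have P_eq: "P = {f. Poly_Mapping.lookup (coefs p q f) 0 * Poly_Mapping.lookup (coefs p q c) 0 \<in> I}"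
    unfolding c by (auto simp: coefs_mult swapped.coefs_mult lookup_mult_zero ideal_mult_left[OF J])
  define Q where "Q = {r. r * Poly_Mapping.lookup (coefs p q c) 0 \<in> I}"
  have PQ: "P = {f. Poly_Mapping.lookup (coefs p q f) 0 \<in> Q}" unfolding P_eq Q_def by simp
  have Q_iff: "r \<in> Q \<longleftrightarrow> rename p r \<in> P" for r unfolding PQ by (simp add: evaluation_rename)
  have "is_ideal Q"
    using prime_ideal_ideal[OF prime] unfolding is_ideal_iff[of Q] Q_iff
    by (auto simp: rename_add rename_mult Q_iff ideal_zero ideal_add ideal_mult_left)
  moreover have "Q \<noteq> UNIV"
    using Q_iff[of 1] prime_ideal_one[OF prime] by auto
  moreover have "a \<in> Q \<or> b \<in> Q" if "a * b \<in> Q" for a b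
    using that prime_ideal_mult[OF prime] by (simp add: Q_iff rename_mult)
  ultimately have "prime_ideal Q" by (auto simp: prime_ideal_def)
  then have "Q \<in> assoc_primes I" unfolding assoc_primes_def Q_def by blast
  with PQ show ?thesis by blast
qed

end

context two_blocks
begin

lemma symb_pow_fiber_product:
  fixes I :: "('x, 'k::comm_ring_1) pol set" and J :: "('y, 'k) pol set"
  defines "F \<equiv> {f. Poly_Mapping.lookup (coefs p q f) 0 \<in> I \<and> Poly_Mapping.lookup (coefs q p f) 0 \<in> J}"
  assumes I: "is_ideal I" "I \<subseteq> max_ideal" and J: "is_ideal J" "J \<subseteq> max_ideal"
    and x: "x \<in> max_ideal" "\<And>a. x * a \<in> I \<Longrightarrow> a \<in> I"
    and z: "z \<in> max_ideal" "\<And>a. z * a \<in> J \<Longrightarrow> a \<in> J"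
  shows "symb_pow F s = {f. coefs p q f \<in> coef_filtration (symb_pow I) s \<and>
    coefs q p f \<in> coef_filtration (symb_pow J) s}"
proof -
  have F_swap: "F = {f. Poly_Mapping.lookup (coefs q p f) 0 \<in> J \<and> Poly_Mapping.lookup (coefs p q f) 0 \<in> I}"
    by (auto simp: F_def)
  have product: "rename p a * rename q b \<in> F" if "a \<in> max_ideal" "b \<in> max_ideal" for a b
    using that by (simp add: F_def coefs_mult swapped.coefs_mult lookup_mult_zero evaluation_rename
        swapped.evaluation_rename ideal_zero I(1) J(1))
  have var: "var i \<in> max_ideal" for i
    unfolding max_ideal_def by (rule subsetD[OF gen_ideal_superset]) simp
  have outside: "c \<notin> P" if "P \<in> assoc_primes K" "\<And>a. c * a \<in> K \<Longrightarrow> a \<in> K"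
    for c P and K :: "('w, 'k) pol set"
    using that prime_ideal_one[of P] by (auto simp: assoc_primes_def)
  have Ass: "assoc_primes F =
      (\<lambda>P. {f. Poly_Mapping.lookup (coefs p q f) 0 \<in> P}) ` assoc_primes I \<union>
      (\<lambda>Q. {f. Poly_Mapping.lookup (coefs q p f) 0 \<in> Q}) ` assoc_primes J"
  proof (intro equalityI subsetI)
    fix P assume P: "P \<in> assoc_primes F"
    then obtain c where prime: "prime_ideal P" and c: "P = {f. f * c \<in> F}"
      by (auto simp: assoc_primes_def)
    have "is_ideal F"
      using is_ideal_evaluation_vimage[OF I(1)] swapped.is_ideal_evaluation_vimage[OF J(1)]
      by (simp add: is_ideal_iff F_def)
    then have "rename p x * rename q z \<in> P"
      unfolding c using product[OF x(1) z(1)] ideal_mult_right by blast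
    then have "rename p x \<in> P \<or> rename q z \<in> P" by (rule prime_ideal_mult[OF prime])
    then show "P \<in> (\<lambda>P. {f. Poly_Mapping.lookup (coefs p q f) 0 \<in> P}) ` assoc_primes I \<union>
      (\<lambda>Q. {f. Poly_Mapping.lookup (coefs q p f) 0 \<in> Q}) ` assoc_primes J"
      using assoc_prime_containing_second[OF P[unfolded F_def] J(1) z]
        swapped.assoc_prime_containing_second[OF P[unfolded F_swap] I(1) x]
      by blast
  next
    fix P assume "P \<in> (\<lambda>P. {f. Poly_Mapping.lookup (coefs p q f) 0 \<in> P}) ` assoc_primes I \<union>
      (\<lambda>Q. {f. Poly_Mapping.lookup (coefs q p f) 0 \<in> Q}) ` assoc_primes J"
    then show "P \<in> assoc_primes F"
      using assoc_prime_evaluation_vimage[OF _ J(1) x I(1)]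
        swapped.assoc_prime_evaluation_vimage[OF _ I(1) z J(1)]
      unfolding F_def[symmetric] F_swap[symmetric] by blast
  qed
  have "saturation {f. Poly_Mapping.lookup (coefs p q f) 0 \<in> P} (ideal_pow F s) =
      {f. \<forall>b. Poly_Mapping.lookup (coefs p q f) b \<in> saturation P (ideal_pow I (s - mon_degree b))}"
    if P: "P \<in> assoc_primes I" for P
  proof (rule saturation_ideal_pow[OF _ I(1)])
    show "prime_ideal P" using P by (simp add: assoc_primes_def)
    show "rename p ` I \<subseteq> F"
      using I(2) by (auto simp: F_def evaluation_rename swapped.evaluation_rename ideal_zero[OF J(1)] subset_iff)
    show "rename p x * rename q (var j) \<in> F" for j
      by (rule product[OF x(1) var])
    show "x \<notin> P" using P x(2) by (rule outside)
  qed (auto simp: F_def)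
  moreover have "saturation {f. Poly_Mapping.lookup (coefs q p f) 0 \<in> P} (ideal_pow F s) =
      {f. \<forall>b. Poly_Mapping.lookup (coefs q p f) b \<in> saturation P (ideal_pow J (s - mon_degree b))}"
    if P: "P \<in> assoc_primes J" for P
  proof (rule swapped.saturation_ideal_pow[OF _ J(1)])
    show "prime_ideal P" using P by (simp add: assoc_primes_def)
    show "rename q ` J \<subseteq> F"
      using J(2) by (auto simp: F_def evaluation_rename swapped.evaluation_rename ideal_zero[OF I(1)] subset_iff)
    show "rename q z * rename p (var i) \<in> F" for i
      using product[OF var z(1)] by (simp add: mult.commute)
    show "z \<notin> P" using P z(2) by (rule outside)
  qed (auto simp: F_def)
  ultimately have "symb_pow F s =
      (\<Inter>P\<in>assoc_primes I. {f. \<forall>b. Poly_Mapping.lookup (coefs p q f) b \<in> saturation P (ideal_pow I (s - mon_degree b))}) \<inter>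
      (\<Inter>P\<in>assoc_primes J. {f. \<forall>b. Poly_Mapping.lookup (coefs q p f) b \<in> saturation P (ideal_pow J (s - mon_degree b))})"
    by (simp add: symb_pow_saturation[of F] Ass INF_union image_image)
  then show ?thesis
    by (auto simp: coef_filtration_def symb_pow_saturation)
qed

end

lemma two_blocks_sum: "two_blocks Inl Inr"
  by unfold_locales (auto simp: UNIV_sum)

lemma homogeneous_ideal_ideal: "homogeneous_ideal K \<Longrightarrow> is_ideal K"
  by (auto simp: homogeneous_ideal_def is_ideal_gen_ideal)

theorem lemma3p3:
  fixes I :: "('x::finite, 'k::field) pol set"
    and J :: "('y::finite, 'k) pol set"
    and F :: "('x + 'y, 'k) pol set"
    and s :: nat
  assumes "homogeneous_ideal I" and "I \<subseteq> ideal_pow max_ideal 2"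
    and "homogeneous_ideal J" and "J \<subseteq> ideal_pow max_ideal 2"
    and "F = extend Inl I + extend Inr J
             + ideal_prod (extend Inl max_ideal) (extend Inr max_ideal)"
    and "min (depth max_ideal I) (depth max_ideal J) \<ge> 1"
    and "s \<ge> 1"
  shows "symb_pow F s =
    (\<Sum>i=0..s. \<Sum>t=0..s.
       ideal_prod (extend Inl (symb_pow I i \<inter> ideal_pow max_ideal (s - t)))
                  (extend Inr (symb_pow J t \<inter> ideal_pow max_ideal (s - i))))"
proof -
  interpret two_blocks "Inl :: 'x \<Rightarrow> 'x + 'y" "Inr :: 'y \<Rightarrow> 'x + 'y"
    by (rule two_blocks_sum)
  have max_square: "ideal_pow max_ideal 2 \<subseteq> (max_ideal :: ('w, 'k) pol set)"
    using ideal_pow_antimono[of "Suc 0" 2 "max_ideal :: ('w, 'k) pol set"]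
    by (simp only: ideal_pow_one[OF is_ideal_max_ideal])
  have I: "is_ideal I" "I \<subseteq> max_ideal" and J: "is_ideal J" "J \<subseteq> max_ideal"
    using assms(1-4) homogeneous_ideal_ideal max_square by blast+
  have "1 \<le> depth max_ideal I" "1 \<le> depth max_ideal J" using assms(6) by simp_all
  then obtain x z where x: "x \<in> max_ideal" "\<And>a. x * a \<in> I \<Longrightarrow> a \<in> I"
    and z: "z \<in> max_ideal" "\<And>a. z * a \<in> J \<Longrightarrow> a \<in> J"
    by (metis depth_nonzerodivisor I(1) J(1))
  define Q where "Q i t = ideal_prod (extend Inl (symb_pow I i \<inter> ideal_pow max_ideal (s - t)))
    (extend Inr (symb_pow J t \<inter> ideal_pow max_ideal (s - i)))" for i t
  define G where "G = (\<Sum>i=0..s. \<Sum>t=0..s. Q i t)"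
  define E where "E = {f. coefs Inl Inr f \<in> coef_filtration (symb_pow I) s \<and>
    coefs Inr Inl f \<in> coef_filtration (symb_pow J) s}"
  have Q: "is_ideal (Q i t)" for i t unfolding Q_def by (rule is_ideal_ideal_prod)
  have G: "is_ideal G" unfolding G_def by (intro ideal_sum_sets Q) simp_all
  have QG: "Q i t \<subseteq> G" if "i \<le> s" "t \<le> s" for i t
  proof -
    have "Q i t \<subseteq> (\<Sum>t=0..s. Q i t)"
      using that by (intro ideal_sum_sets(2)[of _ "Q i"] Q) simp_all
    also have "\<dots> \<subseteq> G"
      unfolding G_def using that
      by (intro ideal_sum_sets(2)[of _ "\<lambda>i. \<Sum>t=0..s. Q i t"] ideal_sum_sets(1) Q) simp_all
    finally show ?thesis .
  qed
  have E: "is_ideal E"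
    using is_ideal_coefs_vimage[OF is_ideal_coef_filtration[of "symb_pow I", OF is_ideal_symb_pow symb_pow_antimono], of s]
      swapped.is_ideal_coefs_vimage[OF is_ideal_coef_filtration[of "symb_pow J", OF is_ideal_symb_pow symb_pow_antimono], of s]
    by (simp add: is_ideal_iff E_def)
  have "Q i t \<subseteq> E" for i t
    unfolding Q_def extend_def
  proof (rule gen_ideal_prod_least[OF E], clarify)
    fix u v assume u: "u \<in> symb_pow I i" "u \<in> ideal_pow max_ideal (s - t)"
      and v: "v \<in> symb_pow J t" "v \<in> ideal_pow max_ideal (s - i)"
    have "coefs Inl Inr (rename Inl u * rename Inr v) \<in> coef_filtration (symb_pow I) s"
      using v(2) by (intro coefs_rename_mult_mem[of "symb_pow I", OF is_ideal_symb_pow symb_pow_antimono u(1)])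
        (auto simp: max_ideal_pow_iff)
    moreover have "coefs Inr Inl (rename Inr v * rename Inl u) \<in> coef_filtration (symb_pow J) s"
      using u(2) by (intro swapped.coefs_rename_mult_mem[of "symb_pow J", OF is_ideal_symb_pow symb_pow_antimono v(1)])
        (auto simp: max_ideal_pow_iff)
    ultimately show "rename Inl u * rename Inr v \<in> E"
      by (simp add: E_def mult.commute)
  qed
  then have "G \<subseteq> E" unfolding G_def by (intro sum_sets_least[OF E])
  moreover have "E \<subseteq> G"
  proof
    fix f assume f: "f \<in> E"
    show "f \<in> G"
    proof (rule rank_one_decomposition[of "symb_pow I" "symb_pow J" G s])
      fix i t u v
      assume "i \<le> s" "t \<le> s" and uv: "u \<in> symb_pow I i \<inter> ideal_pow max_ideal (s - t)"
        "v \<in> symb_pow J t \<inter> ideal_pow max_ideal (s - i)"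
      have "rename Inl u * rename Inr v \<in> Q i t"
        unfolding Q_def extend_def
        by (intro ideal_prod_mem subsetD[OF gen_ideal_superset] imageI uv)
      with QG[OF \<open>i \<le> s\<close> \<open>t \<le> s\<close>] show "rename Inl u * rename Inr v \<in> G" by blast
    qed (use f in \<open>simp_all add: E_def G is_ideal_symb_pow symb_pow_antimono\<close>)
  qed
  moreover have "symb_pow F s = E"
    unfolding E_def assms(5) fiber_product_ideal[OF I J]
    by (rule symb_pow_fiber_product[OF I J x z])
  ultimately show ?thesis by (simp add: G_def Q_def)
qed

end
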